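(* Let $q\in\mathbb{C}$ with $0<|q|<1$ and $x,y\in\mathbb{C}$. Then for every $n\in\mathbb{N}_0$, \[ \mathfrak{E}_{n,q}(x,0)=-\sum_{k=0}^{n}\begin{bmatrix}n\\k\end{bmatrix}_q\frac{2}{[k+1]_q}\,\mathfrak{E}_{k+1,q}\,\mathfrak{B}_{n-k,q}(x,0), \] \[ \mathfrak{E}_{n,q}(0,y)=-\sum_{k=0}^{n}\begin{bmatrix}n\\k\end{bmatrix}_q\frac{2}{[k+1]_q}\,\mathfrak{E}_{k+1,q}\,\mathfrak{B}_{n-k,q}(0,y). \]
   Context: $\mathbb{N}_0=\{0,1,2,\dots\}$. For $q\in\mathbb{C}$, $0<|q|<1$: $[n]_q=\frac{1-q^n}{1-q}$, $[0]_q!=1$, $[n]_q!=[1]_q[2]_q\cdots[n]_q$, and $\begin{bmatrix}n\\k\end{bmatrix}_q=\frac{[n]_q!}{[k]_q![n-k]_q!}$ for $0\le k\le n$. Set $e_q(z)=\sum_{n\ge0}\frac{z^n}{[n]_q!}$ and $E_q(z)=\sum_{n\ge0}\frac{q^{n(n-1)/2}z^n}{[n]_q!}$. The $q$-Bernoulli and $q$-Euler polynomials are defined by the power series expansions in $t$ around $0$ \[ \frac{t}{e_q(t)-1}e_q(tx)E_q(ty)=\sum_{n=0}^\infty\mathfrak{B}_{n,q}(x,y)\frac{t^n}{[n]_q!},\qquad \frac{2}{e_q(t)+1}e_q(tx)E_q(ty)=\sum_{n=0}^\infty\mathfrak{E}_{n,q}(x,y)\frac{t^n}{[n]_q!}, \]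 and $\mathfrak{E}_{n,q}=\mathfrak{E}_{n,q}(0,0)$ are the $q$-Euler numbers. *)

theory Defs
  imports "HOL-Complex_Analysis.Complex_Analysis"
begin

definition q_number :: "complex \<Rightarrow> nat \<Rightarrow> complex" where
  "q_number q n = (1 - q ^ n) / (1 - q)"

definition q_fact :: "complex \<Rightarrow> nat \<Rightarrow> complex" where
  "q_fact q n = (\<Prod>k=1..n. q_number q k)"

text \<open>Only used for \<open>k \<le> n\<close>; for \<open>k > n\<close> the value is a meaningless artefact of truncated
  subtraction.\<close>

definition q_binomial :: "complex \<Rightarrow> nat \<Rightarrow> nat \<Rightarrow> complex" where
  "q_binomial q n k = q_fact q n / (q_fact q k * q_fact q (n - k))"

text \<open>The two \<open>q\<close>-exponential functions as power series; \<open>e_fps q oo (fps_const x * fps_X)\<close> below is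
  \<open>e\<^sub>q(t x)\<close> as a power series in \<open>t\<close>.\<close>

definition e_fps :: "complex \<Rightarrow> complex fps" where
  "e_fps q = Abs_fps (\<lambda>n. 1 / q_fact q n)"

definition E_fps :: "complex \<Rightarrow> complex fps" where
  "E_fps q = Abs_fps (\<lambda>n. q ^ (n * (n - 1) div 2) / q_fact q n)"

text \<open>In \<open>fps_X / (e_fps q - 1)\<close> the divisor has subdegree 1, so that the division of formal power
  series cancels the common factor \<open>t\<close>, i.e. fills in the removable singularity at \<open>t = 0\<close>. The lemmas
  \<open>q_bernoulli_expansion\<close> and \<open>q_euler_expansion\<close> below show that the resulting series is
  indeed the convergent expansion around 0 of the generating function.\<close>

definition q_bernoulli_poly :: "complex \<Rightarrow> nat \<Rightarrow> complex \<Rightarrow> complex \<Rightarrow> complex" where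
  "q_bernoulli_poly q n x y = q_fact q n *
     fps_nth (fps_X / (e_fps q - 1)
              * (e_fps q oo (fps_const x * fps_X)) * (E_fps q oo (fps_const y * fps_X))) n"

definition q_euler_poly :: "complex \<Rightarrow> nat \<Rightarrow> complex \<Rightarrow> complex \<Rightarrow> complex" where
  "q_euler_poly q n x y = q_fact q n *
     fps_nth (2 / (e_fps q + 1)
              * (e_fps q oo (fps_const x * fps_X)) * (E_fps q oo (fps_const y * fps_X))) n"

definition q_euler_number :: "complex \<Rightarrow> nat \<Rightarrow> complex" where
  "q_euler_number q n = q_euler_poly q n 0 0"


subsection \<open>Agreement with the analytic generating functions\<close>

definition e_fun :: "complex \<Rightarrow> complex \<Rightarrow> complex" where
  "e_fun q z = (\<Sum>n. z ^ n / q_fact q n)"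

definition E_fun :: "complex \<Rightarrow> complex \<Rightarrow> complex" where
  "E_fun q z = (\<Sum>n. q ^ (n * (n - 1) div 2) * z ^ n / q_fact q n)"

lemma q_number_norm_ge:
  assumes "norm q < 1" "n > 0"
  shows   "norm (q_number q n) \<ge> (1 - norm q) / norm (1 - q)"
proof -
  have "norm (q ^ n) \<le> norm q ^ 1"
    unfolding norm_power by (rule power_decreasing) (use assms in auto)
  moreover have "norm (1 - q ^ n) \<ge> norm (1 :: complex) - norm (q ^ n)"
    by (rule norm_triangle_ineq2)
  ultimately have "norm (1 - q ^ n) \<ge> 1 - norm q"
    by simp
  thus ?thesis
    by (simp add: q_number_def norm_divide divide_right_mono)
qed

lemma q_fact_norm_ge:
  assumes "norm q < 1"
  shows   "norm (q_fact q n) \<ge> ((1 - norm q) / norm (1 - q)) ^ n"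
proof -
  have "(\<Prod>k=1..n. (1 - norm q) / norm (1 - q)) \<le> (\<Prod>k=1..n. norm (q_number q k))"
    by (intro prod_mono conjI q_number_norm_ge) (use assms in auto)
  thus ?thesis
    by (simp add: q_fact_def prod_norm)
qed

lemma q_fact_nonzero:
  assumes "norm q < 1"
  shows   "q_fact q n \<noteq> 0"
proof -
  have "0 < ((1 - norm q) / norm (1 - q)) ^ n"
    using assms by (intro zero_less_power divide_pos_pos) auto
  also have "\<dots> \<le> norm (q_fact q n)"
    by (rule q_fact_norm_ge) fact
  finally show ?thesis by auto
qed

lemma fps_conv_radius_div_q_fact:
  assumes "norm q < 1" "\<And>n. norm (c n) \<le> 1"
  shows   "fps_conv_radius (Abs_fps (\<lambda>n. c n / q_fact q n)) > 0"
proof -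
  define r where "r = (1 - norm q) / norm (1 - q)"
  have r: "r > 0"
    unfolding r_def using assms by (intro divide_pos_pos) auto
  have "summable (\<lambda>n. c n / q_fact q n * of_real (r / 2) ^ n)"
  proof (rule summable_comparison_test')
    show "summable (\<lambda>n. (1 / 2 :: real) ^ n)"
      by (rule summable_geometric) auto
    fix n :: nat
    have "norm (c n / q_fact q n) \<le> 1 / r ^ n"
      unfolding norm_divide
      by (rule frac_le) (use assms q_fact_norm_ge[of q n] r in \<open>auto simp: r_def\<close>)
    hence "norm (c n / q_fact q n) * (r / 2) ^ n \<le> 1 / r ^ n * (r / 2) ^ n"
      by (rule mult_right_mono) (use r in auto)
    also have "\<dots> = (1 / 2) ^ n"
      using r by (simp add: power_divide)
    finally show "norm (c n / q_fact q n * of_real (r / 2) ^ n) \<le> (1 / 2) ^ n"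
      using r by (simp add: norm_mult norm_power norm_divide del: of_real_divide)
  qed
  hence "ereal (norm (of_real (r / 2) :: complex)) \<le> conv_radius (\<lambda>n. c n / q_fact q n)"
    by (rule conv_radius_geI)
  moreover have "0 < ereal (norm (of_real (r / 2) :: complex))"
    using r by simp
  ultimately have "0 < conv_radius (\<lambda>n. c n / q_fact q n)"
    by (rule less_le_trans[rotated])
  thus ?thesis
    by (simp add: fps_conv_radius_def)
qed

lemma e_fun_expansion:
  assumes "norm q < 1"
  shows   "e_fun q has_fps_expansion e_fps q"
proof -
  have "eval_fps (e_fps q) = e_fun q"
    by (auto simp: fun_eq_iff eval_fps_def e_fps_def e_fun_def)
  thus ?thesis
    using eval_fps_has_fps_expansion[of "e_fps q"]
          fps_conv_radius_div_q_fact[of q "\<lambda>_. 1"] assms by (simp add: e_fps_def)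
qed

lemma E_fun_expansion:
  assumes "norm q < 1"
  shows   "E_fun q has_fps_expansion E_fps q"
proof -
  have "eval_fps (E_fps q) = E_fun q"
    by (auto simp: fun_eq_iff eval_fps_def E_fps_def E_fun_def)
  moreover have "norm (q ^ (n * (n - 1) div 2)) \<le> 1" for n
    using assms by (simp add: norm_power power_le_one)
  ultimately show ?thesis
    using eval_fps_has_fps_expansion[of "E_fps q"]
          fps_conv_radius_div_q_fact[of q "\<lambda>n. q ^ (n * (n - 1) div 2)"] assms
    by (simp add: E_fps_def)
qed

lemma scaled_expansion:
  fixes f :: "complex \<Rightarrow> complex"
  assumes "f has_fps_expansion F"
  shows   "(\<lambda>t. f (t * x)) has_fps_expansion (F oo (fps_const x * fps_X))"
proof -
  have "(f \<circ> (\<lambda>t. x * t)) has_fps_expansion (F oo (fps_const x * fps_X))"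
    by (intro has_fps_expansion_compose assms has_fps_expansion_cmult_left
          has_fps_expansion_fps_X) auto
  thus ?thesis
    by (simp add: o_def mult.commute)
qed

lemma q_bernoulli_expansion:
  assumes "norm q < 1"
  shows   "(\<lambda>t. (if t = 0 then 1 else t / (e_fun q t - 1)) * e_fun q (t * x) * E_fun q (t * y))
             has_fps_expansion Abs_fps (\<lambda>n. q_bernoulli_poly q n x y / q_fact q n)"
proof -
  have q: "q \<noteq> 1" using assms by auto
  have nth: "fps_nth (e_fps q - 1) 0 = 0" "fps_nth (e_fps q - 1) 1 = 1"
    using q by (simp_all add: e_fps_def q_fact_def q_number_def)
  hence sd: "subdegree (e_fps q - 1) = 1"
    by (intro subdegreeI) auto
  have nz: "e_fps q - 1 \<noteq> 0"
    using nth(2) by (metis fps_zero_nth zero_neq_one)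
  have "(\<lambda>t. if t = 0 then 1 else t / (e_fun q t - 1)) has_fps_expansion (fps_X / (e_fps q - 1))"
    by (rule has_fps_expansion_divide)
       (use nz in \<open>auto simp only: sd nth subdegree_fps_X fps_X_nth
          intro!: fps_expansion_intros e_fun_expansion assms\<close>, simp)
  hence "(\<lambda>t. (if t = 0 then 1 else t / (e_fun q t - 1)) * e_fun q (t * x) * E_fun q (t * y))
          has_fps_expansion (fps_X / (e_fps q - 1)
            * (e_fps q oo (fps_const x * fps_X)) * (E_fps q oo (fps_const y * fps_X)))"
    by (intro has_fps_expansion_mult scaled_expansion e_fun_expansion E_fun_expansion assms)
  also have "\<dots> = Abs_fps (\<lambda>n. q_bernoulli_poly q n x y / q_fact q n)"
    by (rule fps_ext) (simp add: q_bernoulli_poly_def q_fact_nonzero assms)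
  finally show ?thesis .
qed

lemma q_euler_expansion:
  assumes "norm q < 1"
  shows   "(\<lambda>t. 2 / (e_fun q t + 1) * e_fun q (t * x) * E_fun q (t * y))
             has_fps_expansion Abs_fps (\<lambda>n. q_euler_poly q n x y / q_fact q n)"
proof -
  have "fps_nth (e_fps q + 1) 0 \<noteq> 0"
    by (simp add: e_fps_def q_fact_def)
  hence "(\<lambda>t. 2 / (e_fun q t + 1)) has_fps_expansion (2 / (e_fps q + 1))"
    by (intro has_fps_expansion_divide' has_fps_expansion_add e_fun_expansion assms) auto
  hence "(\<lambda>t. 2 / (e_fun q t + 1) * e_fun q (t * x) * E_fun q (t * y))
          has_fps_expansion (2 / (e_fps q + 1)
            * (e_fps q oo (fps_const x * fps_X)) * (E_fps q oo (fps_const y * fps_X)))"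
    by (intro has_fps_expansion_mult scaled_expansion e_fun_expansion E_fun_expansion assms)
  also have "\<dots> = Abs_fps (\<lambda>n. q_euler_poly q n x y / q_fact q n)"
    by (rule fps_ext) (simp add: q_euler_poly_def q_fact_nonzero assms)
  finally show ?thesis .
qed

end

theory Submission
  imports Defs
begin

text \<open>
  Write \<open>e\<close> for the series \<open>e\<^sub>q(t)\<close>. The proof compares coefficients in
  \[ \frac{2}{e + 1} = - 2 \cdot \frac{1}{t} \Bigl(\frac{2}{e + 1} - 1\Bigr) \cdot \frac{t}{e - 1} \]
  (\<open>euler_series_conv_bernoulli_series\<close>), which holds because
  \<open>2 / (e + 1) - 1 = - (e - 1) / (e + 1)\<close>. The series \<open>2 / (e + 1)\<close> has
  constant coefficient \<open>1\<close>, so that subtracting \<open>1\<close> and dividing by \<open>t\<close> shifts its coefficients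
  by one place: this is where the Euler numbers of index \<open>k + 1\<close> come from, and
  \<open>[k+1]\<^sub>q! = [k+1]\<^sub>q [k]\<^sub>q!\<close> produces the factor \<open>1 / [k+1]\<^sub>q\<close>.
  Multiplying by \<open>e\<^sub>q(tx) E\<^sub>q(ty)\<close> turns \<open>2 / (e + 1)\<close> on the left into the generating series of the
  \<open>q\<close>-Euler polynomials, and \<open>t / (e - 1)\<close> on the right into that of the \<open>q\<close>-Bernoulli polynomials,
  with both variables at once; the two claimed identities are the cases \<open>y = 0\<close> and \<open>x = 0\<close>
  (\<open>q_euler_poly_conv_q_bernoulli_poly\<close>).
\<close>

lemma q_fact_0 [simp]: "q_fact q 0 = 1"
  by (simp add: q_fact_def)

lemma q_fact_Suc: "q_fact q (Suc n) = q_fact q n * q_number q (Suc n)"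
  by (simp add: q_fact_def)

lemma e_fps_nth_0 [simp]: "fps_nth (e_fps q) 0 = 1"
  by (simp add: e_fps_def)

text \<open>Division of formal power series is exact only when the subdegrees allow it; here
  \<open>e\<^sub>q(t) - 1\<close> starts with \<open>t\<close> itself, as \<open>[1]\<^sub>q = 1\<close>.\<close>

lemma fps_X_div_e_fps_minus_1:
  assumes "q \<noteq> 1"
  shows   "fps_X / (e_fps q - 1) * (e_fps q - 1) = fps_X"
proof -
  have nth1: "fps_nth (e_fps q - 1) 1 = 1"
    using assms by (simp add: e_fps_def q_fact_def q_number_def)
  hence "subdegree (e_fps q - 1) = 1"
    by (intro subdegreeI) auto
  moreover from nth1 have "e_fps q - 1 \<noteq> 0"
    by (metis fps_zero_nth zero_neq_one)
  ultimately have "e_fps q - 1 dvd fps_X"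
    by (simp add: fps_dvd_iff)
  thus ?thesis by simp
qed

lemma two_div_e_fps_plus_1: "2 / (e_fps q + 1) * (e_fps q + 1) = 2"
proof -
  have "is_unit (e_fps q + 1)"
    by (simp add: fps_is_unit_iff)
  thus ?thesis by simp
qed

lemma euler_series_conv_bernoulli_series:
  assumes "q \<noteq> 1"
  shows   "2 / (e_fps q + 1) =
             - (2 * fps_shift 1 (2 / (e_fps q + 1)) * (fps_X / (e_fps q - 1)))"
proof -
  define e where "e = e_fps q"
  define G where "G = 2 / (e + 1)"
  define B where "B = fps_X / (e - 1)"
  have G: "G * (e + 1) = 2" and B: "B * (e - 1) = fps_X"
    unfolding G_def B_def e_def
    using two_div_e_fps_plus_1 fps_X_div_e_fps_minus_1[OF assms] by auto
  have e0: "fps_nth (e + 1) 0 = 2"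
    by (simp add: e_def)
  have "fps_nth G 0 * fps_nth (e + 1) 0 = 2"
    by (metis G fps_mult_nth_0 fps_numeral_nth_0)
  hence "fps_nth G 0 = 1"
    unfolding e0 by simp
  hence shift: "fps_X * fps_shift 1 G = G - 1"
    by (intro fps_ext) (auto simp: fps_X_mult_nth)
  \<comment> \<open>Clearing the denominators \<open>t\<close> and \<open>e + 1\<close> leaves a polynomial identity.\<close>
  have "(fps_X * (e + 1)) * (2 * fps_shift 1 G * B) = 2 * (fps_X * fps_shift 1 G) * (e + 1) * B"
    by (simp only: mult_ac)
  also have "\<dots> = 2 * (G * (e + 1) - (e + 1)) * B"
    unfolding shift by (simp add: algebra_simps)
  also have "\<dots> = - (2 * (B * (e - 1)))"
    unfolding G by (simp add: algebra_simps)
  also have "\<dots> = - ((G * (e + 1)) * fps_X)"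
    unfolding G B ..
  finally have "(fps_X * (e + 1)) * (2 * fps_shift 1 G * B) = (fps_X * (e + 1)) * (- G)"
    by (simp add: algebra_simps)
  moreover have "fps_X * (e + 1) \<noteq> 0"
    using e0 by (metis fps_X_neq_zero fps_zero_nth mult_eq_0_iff zero_neq_numeral)
  ultimately have "2 * fps_shift 1 G * B = - G"
    by (metis mult_left_cancel)
  thus ?thesis
    by (simp add: G_def B_def e_def)
qed

lemma q_euler_number_conv_nth:
  "q_euler_number q n = q_fact q n * fps_nth (2 / (e_fps q + 1)) n"
proof -
  have "F oo (fps_const 0 * fps_X) = fps_const (fps_nth F 0)" for F :: "complex fps"
    by simp
  moreover have "fps_nth (E_fps q) 0 = 1"
    by (simp add: E_fps_def)
  ultimately show ?thesis
    by (simp add: q_euler_number_def q_euler_poly_def)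
qed

theorem q_euler_poly_conv_q_bernoulli_poly:
  assumes "norm q < 1"
  shows   "q_euler_poly q n x y =
             - (\<Sum>k=0..n. q_binomial q n k * (2 / q_number q (k + 1))
                  * q_euler_number q (k + 1) * q_bernoulli_poly q (n - k) x y)"
proof -
  define G where "G = 2 / (e_fps q + 1)"
  define B where "B = fps_X / (e_fps q - 1)"
  define F where "F = (e_fps q oo (fps_const x * fps_X)) * (E_fps q oo (fps_const y * fps_X))"
  from assms have "q \<noteq> 1" by auto
  have nonzero: "q_fact q k \<noteq> 0" for k
    using assms by (rule q_fact_nonzero)
  have summand: "q_binomial q n k * (2 / q_number q (k + 1)) * q_euler_number q (k + 1)
                   * q_bernoulli_poly q (n - k) x y
                 = q_fact q n * (fps_nth (2 * fps_shift 1 G) k * fps_nth (B * F) (n - k))" for k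
  proof -
    have "q_number q (Suc k) \<noteq> 0"
      using nonzero[of "Suc k"] by (auto simp: q_fact_Suc)
    thus ?thesis
      using nonzero
      by (simp add: q_binomial_def q_euler_number_conv_nth q_bernoulli_poly_def q_fact_Suc
            numeral_fps_const G_def B_def F_def mult.assoc field_simps)
  qed
  have "G * F = - ((2 * fps_shift 1 G) * (B * F))"
    using euler_series_conv_bernoulli_series[OF \<open>q \<noteq> 1\<close>]
    by (metis G_def B_def mult.assoc mult_minus_left)
  hence "q_euler_poly q n x y = - (q_fact q n * fps_nth ((2 * fps_shift 1 G) * (B * F)) n)"
    by (simp add: q_euler_poly_def G_def F_def mult.assoc)
  also have "\<dots> = - (\<Sum>k=0..n. q_fact q n *
                      (fps_nth (2 * fps_shift 1 G) k * fps_nth (B * F) (n - k)))"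
    by (simp only: fps_mult_nth sum_distrib_left)
  finally show ?thesis
    by (simp only: summand)
qed

theorem corollary17:
  fixes q x y :: complex and n :: nat
  assumes "0 < norm q" and "norm q < 1"
  shows "q_euler_poly q n x 0 =
           - (\<Sum>k=0..n. q_binomial q n k * (2 / q_number q (k + 1))
                * q_euler_number q (k + 1) * q_bernoulli_poly q (n - k) x 0)
       \<and> q_euler_poly q n 0 y =
           - (\<Sum>k=0..n. q_binomial q n k * (2 / q_number q (k + 1))
                * q_euler_number q (k + 1) * q_bernoulli_poly q (n - k) 0 y)"
  using q_euler_poly_conv_q_bernoulli_poly[OF assms(2)] by blast

end
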